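(* Let $d\le k\le n$ be integers and let $v_1,\dots,v_n\in\mathbb{R}^d$ span $\mathbb{R}^d$. Let $\mathcal{U}$ denote either $\mathcal{U}_k$ or $\mathcal{U}_{\le k}$, and let $\alpha\ge 1$. Suppose that for every vector $x\in[0,1]^n$ with $\sum_i x_i=k$ there exists a probability measure $\mu_x$ on $\mathcal{U}$ that is $\alpha$-approximate $(d-1,d)$-wise independent with respect to $x$. Consider the following randomized procedure: compute an optimal solution $x$ of the convex relaxation $\mathrm{CP}$; sample $\mathcal{S}\in\mathcal{U}$ by proportional volume sampling with measure $\mu_x$, i.e. $\Pr[\mathcal{S}=S]=\mu_x(S)\det(V_SV_S^\top)/\sum_{S'\in\mathcal{U}}\mu_x(S')\det(V_{S'}V_{S'}^\top)$; if $|\mathcal{S}|<k$, add $k-|\mathcal{S}|$ arbitrary further indices to obtain a set $\mathcal{S}'$ of size $k$ (otherwise $\mathcal{S}'=\mathcal{S}$). Then the normalizing sum is positive and $$\mathbb{E}\Big[\operatorname{tr}\big((V_{\mathcal{S}'}V_{\mathcal{S}'}^\top)^{-1}\big)\Big]\le \alpha\cdot \mathrm{OPT}.$$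
   Context: For $v_1,\dots,v_n\in\mathbb{R}^d$ let $V=[v_1,\dots,v_n]\in\mathbb{R}^{d\times n}$, and for $S\subseteq[n]$ let $V_S$ be the $d\times|S|$ submatrix of $V$ with columns indexed by $S$. $\mathcal{U}_k$ is the family of subsets of $[n]$ of size exactly $k$, $\mathcal{U}_{\le k}$ the family of subsets of size at most $k$. The A-optimal design problem (without repetitions) asks for $S\in\mathcal{U}_k$ minimizing $\operatorname{tr}((V_SV_S^\top)^{-1})$ (taken as $+\infty$ if $V_SV_S^\top$ is singular); $\mathrm{OPT}$ is the minimum value. The convex relaxation $\mathrm{CP}$ is: minimize $\operatorname{tr}\big((\sum_{i=1}^n x_iv_iv_i^\top)^{-1}\big)$ subject to $\sum_i x_i=k$, $0\le x_i\le 1$. For $L\subseteq[n]$ write $x^L=\prod_{i\in L}x_i$. A probability measure $\mu$ on $\mathcal{U}_k$ (or $\mathcal{U}_{\le k}$) is called $\alpha$-approximate $(d-1,d)$-wise independent with respect to $x$ if for all $T,R\subseteq[n]$ with $|T|=d-1$, $|R|=d$: $\Pr_{\mathcal{S}\sim\mu}[T\subseteq\mathcal{S}]\cdot x^R\le \alpha\, x^T\cdot \Pr_{\mathcal{S}\sim\mu}[R\subseteq\mathcal{S}]$ (i.e. $\frac{\Pr[T\subseteq\mathcal{S}]}{\Pr[R\subseteq\mathcal{S}]}\le\alpha\frac{x^T}{x^R}$).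
   Formalization: Approximate independence also requires Pr[R ⊆ S] > 0 whenever x^R > 0 and |R| = d (the ratio's denominator is nonzero); otherwise, for sets of size at most k and d ≥ 2, the point mass at the empty set qualifies and the normalizing sum is 0. For sets of size exactly k this is automatic. *)

theory Defs
  imports "HOL-Analysis.Analysis" "HOL-Probability.Probability"
begin

definition subsets_eq :: "nat \<Rightarrow> 'n::finite set set" where
  "subsets_eq k = {S. card S = k}"

definition subsets_le :: "nat \<Rightarrow> 'n::finite set set" where
  "subsets_le k = {S. card S \<le> k}"

text \<open>The ground set \<open>[n]\<close> is a finite type \<open>'n\<close>, and \<open>v i\<close> is the \<open>i\<close>-th column of \<open>V\<close>.
  The number of columns of \<open>V\<^sub>S\<close> depends on \<open>S\<close>, so the \<open>d \<times> d\<close> product \<open>V\<^sub>S V\<^sub>S\<^sup>T\<close> is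
  given by its entries: row \<open>a\<close> of \<open>V\<^sub>S\<close> times row \<open>b\<close> of \<open>V\<^sub>S\<close>.\<close>

definition gram :: "('n::finite \<Rightarrow> real^'d) \<Rightarrow> 'n set \<Rightarrow> real^'d^'d" where
  "gram v S = (\<chi> a b. \<Sum>j\<in>S. v j $ a * v j $ b)"

definition outer :: "real^'d \<Rightarrow> real^'d^'d" where
  "outer u = (\<chi> a b. u $ a * u $ b)"

text \<open>Only applied to positive semidefinite matrices, where the trace of the inverse is nonnegative
  and the embedding into \<open>ennreal\<close> loses nothing.\<close>

definition tr_inv :: "real^'d^'d \<Rightarrow> ennreal" where
  "tr_inv M = (if invertible M then ennreal (trace (matrix_inv M)) else \<infinity>)"

definition OPT :: "('n::finite \<Rightarrow> real^'d) \<Rightarrow> nat \<Rightarrow> ennreal" where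
  "OPT v k = (MIN S\<in>subsets_eq k. tr_inv (gram v S))"

definition cp_feasible :: "nat \<Rightarrow> (real^'n::finite) set" where
  "cp_feasible k = {x. (\<Sum>i\<in>UNIV. x $ i) = real k \<and> (\<forall>i. 0 \<le> x $ i \<and> x $ i \<le> 1)}"

definition cp_objective :: "('n::finite \<Rightarrow> real^'d) \<Rightarrow> real^'n \<Rightarrow> ennreal" where
  "cp_objective v x = tr_inv (\<Sum>i\<in>UNIV. x $ i *\<^sub>R outer (v i))"

definition cp_optimal :: "('n::finite \<Rightarrow> real^'d) \<Rightarrow> nat \<Rightarrow> real^'n \<Rightarrow> bool" where
  "cp_optimal v k x \<longleftrightarrow>
     x \<in> cp_feasible k \<and> (\<forall>y\<in>cp_feasible k. cp_objective v x \<le> cp_objective v y)"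

definition vpow :: "real^'n::finite \<Rightarrow> 'n set \<Rightarrow> real" where
  "vpow x L = (\<Prod>i\<in>L. x $ i)"

definition incl_prob :: "'n::finite set pmf \<Rightarrow> 'n set \<Rightarrow> real" where
  "incl_prob \<mu> T = measure_pmf.prob \<mu> {S. T \<subseteq> S}"

text \<open>The condition is \<open>Pr[T \<subseteq> S] / Pr[R \<subseteq> S] \<le> \<alpha> x\<^sup>T / x\<^sup>R\<close>. Besides the cross-multiplied
  inequality this requires the left denominator to be nonzero whenever the right-hand side is finite,
  i.e. whenever \<open>x\<^sup>R > 0\<close>. Without that clause, for \<open>d \<ge> 2\<close> the point mass at \<open>{}\<close> would qualify
  (both sides being \<open>0\<close>) although its volume-sampling normalizer is \<open>0\<close>. For measures on the subsets of
  size exactly \<open>k \<ge> d\<close> the clause follows from the inequality, see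
  \<open>incl_prob_pos_of_subsets_eq\<close>.\<close>

definition approx_indep :: "nat \<Rightarrow> real \<Rightarrow> real^'n::finite \<Rightarrow> 'n set pmf \<Rightarrow> bool" where
  "approx_indep d \<alpha> x \<mu> \<longleftrightarrow>
     (\<forall>T R. card T = d - 1 \<longrightarrow> card R = d \<longrightarrow>
        incl_prob \<mu> T * vpow x R \<le> \<alpha> * vpow x T * incl_prob \<mu> R \<and>
        (0 < vpow x R \<longrightarrow> 0 < incl_prob \<mu> R))"

definition vol_norm :: "('n::finite \<Rightarrow> real^'d) \<Rightarrow> 'n set set \<Rightarrow> 'n set pmf \<Rightarrow> real" where
  "vol_norm v U \<mu> = (\<Sum>S\<in>U. pmf \<mu> S * det (gram v S))"

definition vol_sampling :: "('n::finite \<Rightarrow> real^'d) \<Rightarrow> 'n set set \<Rightarrow> 'n set pmf \<Rightarrow> 'n set pmf" where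
  "vol_sampling v U \<mu> = embed_pmf (\<lambda>S. pmf \<mu> S * det (gram v S) / vol_norm v U \<mu>)"

lemma incl_prob_pos_of_subsets_eq:
  fixes \<mu> :: "'n::finite set pmf"
  assumes "set_pmf \<mu> \<subseteq> subsets_eq k" "d \<le> k" "card R = d" "0 < vpow x R"
    and ineq: "\<And>T. card T = d - 1 \<Longrightarrow> incl_prob \<mu> T * vpow x R \<le> \<alpha> * vpow x T * incl_prob \<mu> R"
  shows "0 < incl_prob \<mu> R"
proof -
  obtain S where S: "S \<in> set_pmf \<mu>" using set_pmf_not_empty[of \<mu>] by blast
  then have "d - 1 \<le> card S" using assms(1,2) by (auto simp: subsets_eq_def)
  then obtain T where T: "T \<subseteq> S" "card T = d - 1" by (meson obtain_subset_with_card_n)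
  have "0 < incl_prob \<mu> T"
    unfolding incl_prob_def using S T(1) by (auto intro: measure_pmf_posI)
  then have "0 < \<alpha> * vpow x T * incl_prob \<mu> R"
    using ineq[OF T(2)] assms(4) by (meson mult_pos_pos order_less_le_trans)
  moreover have "0 \<le> incl_prob \<mu> R" by (simp add: incl_prob_def)
  ultimately show ?thesis by (cases "incl_prob \<mu> R = 0") auto
qed

lemma inner_gram: "y \<bullet> (gram v S *v y) = (\<Sum>j\<in>S. (v j \<bullet> y)\<^sup>2)"
proof -
  have "y \<bullet> (gram v S *v y) = (\<Sum>a\<in>UNIV. \<Sum>b\<in>UNIV. \<Sum>j\<in>S. (v j $ a * y $ a) * (v j $ b * y $ b))"
    by (simp add: inner_vec_def matrix_vector_mult_def gram_def sum_distrib_left sum_distrib_right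
        mult_ac)
  also have "\<dots> = (\<Sum>j\<in>S. \<Sum>a\<in>UNIV. \<Sum>b\<in>UNIV. (v j $ a * y $ a) * (v j $ b * y $ b))"
    by (simp only: sum.swap[of _ S])
  finally show ?thesis
    by (simp add: inner_vec_def power2_eq_square sum_product)
qed

lemma det_gram_nonneg: "0 \<le> det (gram v S)"
proof (rule ccontr)
  assume "\<not> 0 \<le> det (gram v S)"
  define N where "N t = (1 - t) *\<^sub>R gram v S + t *\<^sub>R mat 1" for t :: real
  have "continuous_on {0..1} (\<lambda>t. det (N t))"
    unfolding det_def N_def by (auto intro!: continuous_intros)
  moreover have "det (N 0) \<le> 0" "0 \<le> det (N 1)"
    using \<open>\<not> 0 \<le> det (gram v S)\<close> by (auto simp: N_def)
  ultimately obtain t where t: "0 \<le> t" "t \<le> 1" "det (N t) = 0"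
    using IVT'[of "\<lambda>t. det (N t)" 0 0 1] by auto
  then have "t \<noteq> 0" using \<open>\<not> 0 \<le> det (gram v S)\<close> by (auto simp: N_def)
  obtain y where y: "N t *v y = 0" "y \<noteq> 0"
    using t(3) invertible_det_nz[of "N t"] matrix_left_invertible_ker[of "N t"] invertible_left_inverse[of "N t"]
    by auto
  have "y \<bullet> (N t *v y) = (1 - t) * (y \<bullet> (gram v S *v y)) + t * (y \<bullet> y)"
    by (simp add: N_def matrix_vector_mult_add_rdistrib inner_add_right
        flip: scaleR_matrix_vector_assoc)
  moreover have "0 < t * (y \<bullet> y)" using t \<open>t \<noteq> 0\<close> y by simp
  moreover have "0 \<le> (1 - t) * (y \<bullet> (gram v S *v y))"
    using t by (simp add: inner_gram sum_nonneg)
  ultimately show False using y by simp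
qed

lemma pmf_vol_sampling:
  fixes v :: "'n::finite \<Rightarrow> real^'d"
  assumes "set_pmf \<mu> \<subseteq> U" "0 < vol_norm v U \<mu>"
  shows "pmf (vol_sampling v U \<mu>) S = pmf \<mu> S * det (gram v S) / vol_norm v U \<mu>"
proof -
  let ?f = "\<lambda>S. pmf \<mu> S * det (gram v S) / vol_norm v U \<mu>"
  have nn: "0 \<le> ?f S" for S using assms(2) by (simp add: det_gram_nonneg)
  have "(\<Sum>S\<in>UNIV. ?f S) = (\<Sum>S\<in>U. ?f S)"
    using assms(1) by (intro sum.mono_neutral_right) (auto simp: set_pmf_iff)
  also have "\<dots> = 1" using assms(2) by (simp add: vol_norm_def flip: sum_divide_distrib)
  finally have "(\<integral>\<^sup>+S. ennreal (?f S) \<partial>count_space UNIV) = 1"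
    using nn by (simp add: nn_integral_count_space_finite sum_ennreal)
  then show ?thesis unfolding vol_sampling_def using nn by (intro pmf_embed_pmf) auto
qed

end

theory Submission
  imports Defs
begin

text \<open>Write \<open>M(w) = \<Sum>i. w i v i (v i)\<^sup>T\<close>. Both \<open>det M(w)\<close> and \<open>det M(w) tr (M(w)\<^sup>-\<^sup>1)\<close> are multilinear
  in \<open>w\<close> with nonnegative coefficients \<open>c R\<close> and \<open>g T\<close>, supported on sets of size \<open>d\<close> and \<open>d - 1\<close>
  respectively. With weights the indicator of \<open>S\<close>, averaging over \<open>\<mu>\<close> replaces \<open>w\<^sup>R\<close> by \<open>Pr[R \<subseteq> S]\<close>, so
  the expected trace is at most \<open>(\<Sum>T. g T Pr[T \<subseteq> S]) / (\<Sum>R. c R Pr[R \<subseteq> S])\<close>. Approximate independence, applied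
  to each pair \<open>(T, R)\<close>, bounds this by \<open>\<alpha> (\<Sum>T. g T x\<^sup>T) / (\<Sum>R. c R x\<^sup>R) = \<alpha> tr (M(x)\<^sup>-\<^sup>1)\<close>, the
  value of the relaxation. Enlarging \<open>S\<close> only decreases the trace of the inverse.\<close>

section \<open>Multilinear expansion of the determinant of a weighted sum of outer products\<close>

lemma gram_eq_sum_outer: "gram v S = (\<Sum>j\<in>S. outer (v j))"
  by (simp add: gram_def outer_def vec_eq_iff)

lemma gram_eq_weighted_sum:
  "gram v S = (\<Sum>j\<in>UNIV. of_bool (j \<in> S) *\<^sub>R outer (v j))" for v :: "'n::finite \<Rightarrow> real^'d"
proof -
  have "(\<Sum>j\<in>UNIV. of_bool (j \<in> S) *\<^sub>R outer (v j)) = (\<Sum>j\<in>UNIV. if j \<in> S then outer (v j) else 0)"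
    by (rule sum.cong) auto
  then show ?thesis
    by (simp add: gram_eq_sum_outer flip: sum.inter_filter)
qed

lemma prod_of_bool_subset:
  "finite R \<Longrightarrow> (\<Prod>i\<in>R. of_bool (i \<in> S)) = (of_bool (R \<subseteq> S) :: 'a::comm_semiring_1)"
  by (induction R rule: finite_induct) auto

lemma det_rows_sum:
  fixes a :: "'d \<Rightarrow> 'n::finite \<Rightarrow> real^'d"
  shows "det (\<chi> i. \<Sum>j\<in>UNIV. a i j) = (\<Sum>f\<in>UNIV. det (\<chi> i. a i (f i)))"
proof -
  have "(\<Prod>i\<in>UNIV. \<Sum>j\<in>UNIV. a i j $ p i) = (\<Sum>f\<in>UNIV. \<Prod>i\<in>UNIV. a i (f i) $ p i)" for p
    using prod_sum_PiE[of "UNIV :: 'd set" "\<lambda>_. UNIV :: 'n set" "\<lambda>i j. a i j $ p i"]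
    by (simp add: PiE_UNIV_domain)
  then show ?thesis
    by (simp add: det_def sum_distrib_left sum.swap[of _ "{p. p permutes UNIV}" UNIV])
qed

text \<open>Row \<open>a\<close> of the matrix is \<open>\<Sum>i. (w i * u i $ a) *s u i\<close>.
  Expanding every row picks one index \<open>f a\<close> per row; a choice that is not injective
  repeats a row and contributes zero.\<close>

lemma det_weighted_sum_outer_inj:
  fixes u :: "'n::finite \<Rightarrow> real^'d"
  shows "det (\<Sum>i\<in>UNIV. w i *\<^sub>R outer (u i)) =
    (\<Sum>f | inj f. (\<Prod>a\<in>UNIV. w (f a)) * ((\<Prod>a\<in>UNIV. u (f a) $ a) * det (\<chi> a. u (f a))))"
    (is "_ = (\<Sum>f | inj f. ?h f)")
proof -
  have "(\<Sum>i\<in>UNIV. w i *\<^sub>R outer (u i)) = (\<chi> a. \<Sum>i\<in>UNIV. (w i * u i $ a) *s u i)"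
    by (simp add: vec_eq_iff outer_def mult.assoc)
  then have "det (\<Sum>i\<in>UNIV. w i *\<^sub>R outer (u i)) =
      (\<Sum>f\<in>UNIV. det (\<chi> a. (w (f a) * u (f a) $ a) *s u (f a)))"
    by (simp only: det_rows_sum)
  also have "\<dots> = (\<Sum>f\<in>UNIV. ?h f)"
    by (simp add: det_rows_mul prod.distrib mult.assoc)
  also have "\<dots> = (\<Sum>f | inj f. ?h f)"
  proof (rule sum.mono_neutral_right)
    show "\<forall>f\<in>UNIV - {f. inj f}. ?h f = 0"
    proof
      fix f :: "'d \<Rightarrow> 'n" assume "f \<in> UNIV - {f. inj f}"
      then obtain a b where "a \<noteq> b" "f a = f b" by (auto simp: inj_def)
      then have "det (\<chi> a. u (f a)) = 0"
        by (intro det_identical_rows[of a b]) (auto simp: row_def vec_eq_iff)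
      then show "?h f = 0" by simp
    qed
  qed auto
  finally show ?thesis .
qed

text \<open>Comparing with the weights \<open>of_bool (i \<in> R)\<close> identifies the coefficient of \<open>\<Prod>i\<in>R. w i\<close> without
  computing it; this replaces the Cauchy--Binet formula.\<close>

lemma det_weighted_sum_outer:
  fixes u :: "'n::finite \<Rightarrow> real^'d"
  shows "det (\<Sum>i\<in>UNIV. w i *\<^sub>R outer (u i)) =
    (\<Sum>R | card R = CARD('d). (\<Prod>i\<in>R. w i) * det (gram u R))"
proof -
  define h where "h f = (\<Prod>a\<in>UNIV. u (f a) $ a) * det (\<chi> a. u (f a))" for f :: "'d \<Rightarrow> 'n"
  have prod_range: "(\<Prod>a\<in>UNIV. w (f a)) = (\<Prod>i\<in>range f. w i)" if "inj f" for f :: "'d \<Rightarrow> 'n" and w :: "'n \<Rightarrow> real"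
    using that by (simp add: prod.reindex)
  have coeff: "det (gram u R) = (\<Sum>f\<in>{f\<in>{f. inj f}. range f = R}. h f)" if R: "card R = CARD('d)" for R
  proof -
    have "det (gram u R) = (\<Sum>f | inj f. of_bool (range f \<subseteq> R) * h f)"
      unfolding gram_eq_weighted_sum det_weighted_sum_outer_inj h_def
      using prod_range[of _ "\<lambda>i. of_bool (i \<in> R)"]
      by (intro sum.cong) (simp_all only: mem_Collect_eq prod_of_bool_subset finite)
    \<comment> \<open>An injective \<open>f\<close> has a range of the same size as
      \<open>R\<close>, so the range lies inside \<open>R\<close> only if it is all of
      \<open>R\<close>.\<close>
    also have "\<dots> = (\<Sum>f | inj f. of_bool (range f = R) * h f)"
    proof (rule sum.cong)
      fix f :: "'d \<Rightarrow> 'n" assume "f \<in> {f. inj f}"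
      then have "card (range f) = card R" using R by (simp add: card_image)
      then have "range f \<subseteq> R \<longleftrightarrow> range f = R" using card_subset_eq[of R "range f"] by auto
      then show "of_bool (range f \<subseteq> R) * h f = of_bool (range f = R) * h f" by simp
    qed simp
    also have "\<dots> = (\<Sum>f\<in>{f\<in>{f. inj f}. range f = R}. h f)"
      by (rule sum.mono_neutral_cong_right) auto
    finally show ?thesis .
  qed
  have "det (\<Sum>i\<in>UNIV. w i *\<^sub>R outer (u i)) = (\<Sum>f | inj f. (\<Prod>i\<in>range f. w i) * h f)"
    unfolding det_weighted_sum_outer_inj h_def by (rule sum.cong) (auto simp: prod_range)
  also have "\<dots> = (\<Sum>R | card R = CARD('d). \<Sum>f\<in>{f\<in>{f. inj f}. range f = R}. (\<Prod>i\<in>range f. w i) * h f)"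
    by (rule sum.group[symmetric]) (auto simp: card_image)
  also have "\<dots> = (\<Sum>R | card R = CARD('d). (\<Prod>i\<in>R. w i) * det (gram u R))"
    by (rule sum.cong) (auto simp: coeff sum_distrib_left intro!: sum.cong)
  finally show ?thesis .
qed

section \<open>Multilinear expansion of the determinant times the trace of the inverse\<close>

lemma matrix_inv_vec_mult: "invertible A \<Longrightarrow> A *v (matrix_inv A *v b) = b" for A :: "real^'d^'d"
  unfolding invertible_def matrix_inv_def matrix_vector_mul_assoc
  by (metis (mono_tags, lifting) someI_ex matrix_vector_mul_lid)

lemma trace_matrix_inv: "trace (matrix_inv A) = (\<Sum>a\<in>UNIV. (matrix_inv A *v axis a 1) $ a)"
  for A :: "real^'d^'d"
  by (simp add: trace_def matrix_vector_mult_basis column_def)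

text \<open>Adding \<open>outer (axis a 1)\<close> changes only column \<open>a\<close>, which
  becomes \<open>A *v z\<close> for \<open>z = matrix_inv A *v axis a 1 + axis a 1\<close>. Cramer's
  rule gives the determinant \<open>z $ a * det A\<close>.\<close>

lemma det_add_outer_axis:
  fixes A :: "real^'d^'d"
  assumes "invertible A"
  shows "det (A + outer (axis a 1)) = det A + (matrix_inv A *v axis a 1) $ a * det A"
proof -
  let ?z = "matrix_inv A *v axis a 1 + axis a 1"
  have "A *v ?z = axis a 1 + column a A"
    using matrix_inv_vec_mult[OF assms, of "axis a 1"]
    by (simp add: matrix_vector_right_distrib matrix_vector_mult_basis del: matrix_vector_mul_assoc)
  then have "A + outer (axis a 1) = (\<chi> i j. if j = a then (A *v ?z) $ i else A $ i $ j)"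
    by (auto simp: vec_eq_iff outer_def column_def axis_def)
  then show ?thesis
    using cramer_lemma[of a A ?z] by (simp add: algebra_simps)
qed

text \<open>Coefficient of \<open>w\<^sup>T\<close> in the trace of the adjugate of \<open>\<Sum>i. w i v i (v i)\<^sup>T\<close>: by the matrix determinant
  lemma, that trace is the sum of the increments of the determinant when one more rank-one term
  \<open>e\<^sub>a e\<^sub>a\<^sup>T\<close>, indexed here by \<open>None\<close>, is added.\<close>

definition adj_coeff :: "('n::finite \<Rightarrow> real^'d) \<Rightarrow> 'n set \<Rightarrow> real" where
  "adj_coeff v T = (\<Sum>a\<in>UNIV. det (gram (case_option (axis a 1) v) (insert None (Some ` T))))"

lemma adj_coeff_nonneg: "0 \<le> adj_coeff v T"
  by (simp add: adj_coeff_def det_gram_nonneg sum_nonneg)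

lemma gram_case_option_Some: "gram (case_option e v) (Some ` R) = gram v R"
  by (simp add: gram_eq_sum_outer sum.reindex)

text \<open>A set either avoids \<open>None\<close> and is an image under \<open>Some\<close>, or is
  \<open>None\<close> added to such an image. At \<open>d = 0\<close>, truncated subtraction would
  put the singleton \<open>{None}\<close> into the second sum.\<close>

lemma sum_sets_option:
  fixes F :: "'n::finite option set \<Rightarrow> real"
  assumes "0 < d"
  shows "(\<Sum>R | card R = d. F R) =
    (\<Sum>R | card R = d. F (Some ` R)) + (\<Sum>T | card T = d - 1. F (insert None (Some ` T)))"
proof -
  have 1: "{R :: 'n option set. card R = d \<and> None \<notin> R} = (`) Some ` {R. card R = d}"
  proof (intro set_eqI iffI)
    fix R :: "'n option set" assume R: "R \<in> {R. card R = d \<and> None \<notin> R}"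
    then have "R = Some ` (Some -` R)" by (auto simp: image_iff) (metis option.exhaust)
    with R show "R \<in> (`) Some ` {R. card R = d}"
      by (metis (mono_tags, lifting) card_image image_eqI inj_Some mem_Collect_eq)
  qed (auto simp: card_image)
  have 2: "{R :: 'n option set. card R = d \<and> None \<in> R} = (\<lambda>T. insert None (Some ` T)) ` {T. card T = d - 1}"
  proof (intro set_eqI iffI)
    fix R :: "'n option set" assume R: "R \<in> {R. card R = d \<and> None \<in> R}"
    define T where "T = Some -` R"
    have T: "R = insert None (Some ` T)"
      using R by (auto simp: T_def image_iff)
    then have "card R = Suc (card T)" by (simp add: card_image)
    then have "card T = d - 1" using R by auto
    with T show "R \<in> (\<lambda>T. insert None (Some ` T)) ` {T. card T = d - 1}" by blast
  qed (use assms in \<open>auto simp: card_image\<close>)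
  have "(\<Sum>R | card R = d. F R) = (\<Sum>R | card R = d \<and> None \<notin> R. F R) + (\<Sum>R | card R = d \<and> None \<in> R. F R)"
    by (subst sum.union_disjoint[symmetric]) (auto intro!: sum.cong)
  moreover have "inj_on (\<lambda>T. insert None (Some ` T)) {T :: 'n set. card T = d - 1}"
    by (auto simp: inj_on_def)
  moreover have "inj_on ((`) Some) {R :: 'n set. card R = d}"
    by (auto simp: inj_on_def)
  ultimately show ?thesis
    unfolding 1 2 by (simp add: sum.reindex)
qed

lemma det_mult_trace_inv_weighted_sum_outer:
  fixes v :: "'n::finite \<Rightarrow> real^'d"
  defines "M w \<equiv> (\<Sum>i\<in>UNIV. w i *\<^sub>R outer (v i))"
  assumes inv: "invertible (M w)"
  shows "det (M w) * trace (matrix_inv (M w)) = (\<Sum>T | card T = CARD('d) - 1. (\<Prod>i\<in>T. w i) * adj_coeff v T)"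
proof -
  have incr: "(matrix_inv (M w) *v axis a 1) $ a * det (M w) =
      (\<Sum>T | card T = CARD('d) - 1. (\<Prod>i\<in>T. w i) *
         det (gram (case_option (axis a 1) v) (insert None (Some ` T))))" for a
  proof -
    \<comment> \<open>\<open>None\<close> carries the vector \<open>axis a 1\<close> with weight 1,
      so the perturbed matrix is again a weighted sum of outer products, now over
      \<open>'n option\<close>.\<close>
    let ?v = "case_option (axis a 1) v" and ?w = "case_option 1 w"
    have "M w + outer (axis a 1) = (\<Sum>i\<in>UNIV. ?w i *\<^sub>R outer (?v i))"
      by (simp add: M_def UNIV_option_conv sum.reindex add.commute)
    then have "det (M w + outer (axis a 1)) = (\<Sum>R | card R = CARD('d). (\<Prod>i\<in>R. ?w i) * det (gram ?v R))"
      by (simp add: det_weighted_sum_outer)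
    \<comment> \<open>Sets without \<open>None\<close> reproduce \<open>det (M w)\<close>, so those
      containing \<open>None\<close> make up exactly the increment.\<close>
    also have "\<dots> = (\<Sum>R | card R = CARD('d). (\<Prod>i\<in>R. w i) * det (gram v R)) +
        (\<Sum>T | card T = CARD('d) - 1. (\<Prod>i\<in>T. w i) * det (gram ?v (insert None (Some ` T))))"
      by (subst sum_sets_option) (auto simp: prod.reindex gram_case_option_Some)
    also have "(\<Sum>R | card R = CARD('d). (\<Prod>i\<in>R. w i) * det (gram v R)) = det (M w)"
      by (simp add: M_def det_weighted_sum_outer)
    finally show ?thesis using det_add_outer_axis[OF inv, of a] by simp
  qed
  have "det (M w) * trace (matrix_inv (M w)) = (\<Sum>a\<in>UNIV. (matrix_inv (M w) *v axis a 1) $ a * det (M w))"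
    by (simp add: trace_matrix_inv sum_distrib_left mult.commute)
  also have "\<dots> = (\<Sum>T | card T = CARD('d) - 1. (\<Prod>i\<in>T. w i) * adj_coeff v T)"
    unfolding incr adj_coeff_def by (subst sum.swap) (simp add: sum_distrib_left)
  finally show ?thesis .
qed

text \<open>The Cauchy-Binet formula, read off from the expansion at indicator weights.\<close>

lemma det_gram_expansion:
  "det (gram v S) = (\<Sum>R | card R = CARD('d). of_bool (R \<subseteq> S) * det (gram v R))"
  for v :: "'n::finite \<Rightarrow> real^'d"
  by (subst gram_eq_weighted_sum) (simp add: det_weighted_sum_outer prod_of_bool_subset)

lemma det_mult_trace_inv_gram:
  fixes v :: "'n::finite \<Rightarrow> real^'d"
  assumes "invertible (gram v S)"
  shows "det (gram v S) * trace (matrix_inv (gram v S)) =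
    (\<Sum>T | card T = CARD('d) - 1. of_bool (T \<subseteq> S) * adj_coeff v T)"
  using det_mult_trace_inv_weighted_sum_outer[of "\<lambda>i. of_bool (i \<in> S)" v] assms
  by (simp add: prod_of_bool_subset flip: gram_eq_weighted_sum)

section \<open>Monotonicity of the trace of the inverse\<close>

lemma inner_gram_bilinear: "y \<bullet> (gram v S *v z) = (\<Sum>j\<in>S. (v j \<bullet> y) * (v j \<bullet> z))"
proof -
  have "gram v S *v z = (\<Sum>j\<in>S. (v j \<bullet> z) *\<^sub>R v j)"
    by (simp add: vec_eq_iff matrix_vector_mult_def gram_def inner_vec_def sum_distrib_right)
       (auto simp: mult_ac sum.swap[of _ UNIV S])
  then show ?thesis
    by (simp add: inner_sum_right inner_commute mult.commute)
qed

text \<open>A singular \<open>gram v S\<close> has infinite value. Otherwise the determinant can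
  only grow with the set, so both matrices are invertible, and their inverses are compared one
  diagonal entry at a time.\<close>

lemma tr_inv_gram_antimono:
  fixes v :: "'n::finite \<Rightarrow> real^'d"
  assumes "S \<subseteq> S'"
  shows "tr_inv (gram v S') \<le> tr_inv (gram v S)"
proof (cases "invertible (gram v S)")
  case True
  have "det (gram v S) \<le> det (gram v S')"
    unfolding det_gram_expansion[of v S] det_gram_expansion[of v S']
    using assms by (intro sum_mono) (auto simp: det_gram_nonneg)
  with True have inv': "invertible (gram v S')"
    using det_gram_nonneg[of v S] by (auto simp: invertible_det_nz)
  have "(matrix_inv (gram v S') *v axis a 1) $ a \<le> (matrix_inv (gram v S) *v axis a 1) $ a" for a
  proof -
    define z where "z = matrix_inv (gram v S) *v axis a 1"
    define y where "y = matrix_inv (gram v S') *v axis a 1"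
    have Az: "gram v S *v z = axis a 1" and By: "gram v S' *v y = axis a 1"
      using True inv' by (simp_all add: z_def y_def matrix_inv_vec_mult)
    \<comment> \<open>With \<open>A = gram v S\<close> and \<open>B = gram v S'\<close> these are
      the forms \<open>z^T A z\<close>, \<open>y^T B y\<close> and \<open>y^T A z\<close>. Hence
      \<open>0 \<le> (y - z)^T A (y - z) \<le> y $ a - 2 * y $ a + z $ a\<close>.\<close>
    have "z $ a = (\<Sum>j\<in>S. (v j \<bullet> z)\<^sup>2)" "y $ a = (\<Sum>j\<in>S'. (v j \<bullet> y)\<^sup>2)"
      "y $ a = (\<Sum>j\<in>S. (v j \<bullet> y) * (v j \<bullet> z))"
      using inner_gram[of z v S] inner_gram[of y v S'] inner_gram_bilinear[of y v S z]
      by (simp_all add: Az By inner_axis)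
    moreover have "0 \<le> (\<Sum>j\<in>S. (v j \<bullet> y - v j \<bullet> z)\<^sup>2)" by (simp add: sum_nonneg)
    moreover have "(\<Sum>j\<in>S. (v j \<bullet> y - v j \<bullet> z)\<^sup>2) =
        (\<Sum>j\<in>S. (v j \<bullet> y)\<^sup>2) + (\<Sum>j\<in>S. (v j \<bullet> z)\<^sup>2) - 2 * (\<Sum>j\<in>S. (v j \<bullet> y) * (v j \<bullet> z))"
      by (simp add: power2_diff sum_subtractf sum.distrib sum_distrib_left mult.assoc)
    moreover have "(\<Sum>j\<in>S. (v j \<bullet> y)\<^sup>2) \<le> (\<Sum>j\<in>S'. (v j \<bullet> y)\<^sup>2)"
      using assms by (intro sum_mono2) auto
    ultimately show ?thesis by (simp add: z_def y_def)
  qed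
  then have "trace (matrix_inv (gram v S')) \<le> trace (matrix_inv (gram v S))"
    unfolding trace_matrix_inv by (rule sum_mono)
  with True inv' show ?thesis by (simp add: tr_inv_def ennreal_leI)
qed (simp add: tr_inv_def)

section \<open>The convex relaxation\<close>

text \<open>The quadratic form at a kernel vector is a vanishing sum of squares, so that vector is
  orthogonal to every \<open>v j\<close>, hence to their span and to itself.\<close>

lemma invertible_gram_span:
  fixes v :: "'n::finite \<Rightarrow> real^'d"
  assumes "span (range v) = UNIV"
  shows "invertible (gram v UNIV)"
proof -
  have "y = 0" if "gram v UNIV *v y = 0" for y
  proof -
    have "(\<Sum>j\<in>UNIV. (v j \<bullet> y)\<^sup>2) = 0" using inner_gram[of y v UNIV] that by simp
    then have "y \<bullet> v j = 0" for j by (simp add: sum_nonneg_eq_0_iff inner_commute)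
    then have "orthogonal y z" if "z \<in> range v" for z using that by (auto simp: orthogonal_def)
    then have "orthogonal y y" using orthogonal_to_span[of y "range v"] assms by auto
    then show ?thesis by (simp add: orthogonal_def)
  qed
  then show ?thesis
    using matrix_left_invertible_ker invertible_left_inverse by blast
qed

text \<open>The uniform weights \<open>k / CARD('n)\<close> are feasible with finite objective, so
  the optimal value is finite, which excludes a singular matrix.\<close>

lemma invertible_of_cp_optimal:
  fixes v :: "'n::finite \<Rightarrow> real^'d"
  assumes "0 < k" "k \<le> CARD('n)" "span (range v) = UNIV" "cp_optimal v k x"
  shows "invertible (\<Sum>i\<in>UNIV. x $ i *\<^sub>R outer (v i))"
proof -
  define c where "c = real k / CARD('n)"
  have c: "0 < c" "c \<le> 1" using assms by (auto simp: c_def divide_le_eq_1)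
  then have "((\<chi> i. c) :: real^'n) \<in> cp_feasible k"
    by (simp add: cp_feasible_def c_def)
  then have "cp_objective v x \<le> cp_objective v (\<chi> i. c)"
    using assms(4) by (simp add: cp_optimal_def)
  also have "(\<Sum>i\<in>UNIV. c *\<^sub>R outer (v i)) = c *\<^sub>R gram v UNIV"
    by (simp add: gram_eq_sum_outer scaleR_right.sum)
  then have "cp_objective v (\<chi> i. c) < \<infinity>"
    using c invertible_gram_span[OF assms(3)] by (simp add: cp_objective_def tr_inv_def scalar_invertible_iff)
  finally show ?thesis by (auto simp: cp_objective_def tr_inv_def split: if_splits)
qed

text \<open>Indicator vectors of sets of size \<open>k\<close> are feasible and have the same
  objective value as the set.\<close>

lemma cp_objective_optimal_le_OPT:
  fixes v :: "'n::finite \<Rightarrow> real^'d"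
  assumes "k \<le> CARD('n)" "cp_optimal v k x"
  shows "cp_objective v x \<le> OPT v k"
proof -
  \<comment> \<open>The minimum in \<open>OPT\<close> is only meaningful over a nonempty
    family.\<close>
  have "subsets_eq k \<noteq> ({} :: 'n set set)"
    using obtain_subset_with_card_n[of k "UNIV :: 'n set"] assms(1) by (auto simp: subsets_eq_def)
  moreover have "cp_objective v x \<le> tr_inv (gram v S)" if S: "S \<in> subsets_eq k" for S
  proof -
    have "(\<chi> i. of_bool (i \<in> S)) \<in> cp_feasible k"
      using S by (auto simp: cp_feasible_def subsets_eq_def)
    then have "cp_objective v x \<le> cp_objective v (\<chi> i. of_bool (i \<in> S))"
      using assms(2) by (simp add: cp_optimal_def)
    then show ?thesis by (simp add: cp_objective_def flip: gram_eq_weighted_sum)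
  qed
  ultimately show ?thesis by (simp add: OPT_def)
qed

section \<open>Averaging over the measure and volume sampling\<close>

lemma incl_prob_eq_sum:
  assumes "set_pmf \<mu> \<subseteq> U"
  shows "incl_prob \<mu> R = (\<Sum>S\<in>U. pmf \<mu> S * of_bool (R \<subseteq> S))"
proof -
  have "incl_prob \<mu> R = (\<Sum>S | R \<subseteq> S. pmf \<mu> S)"
    by (simp add: incl_prob_def measure_measure_pmf_finite)
  also have "\<dots> = (\<Sum>S\<in>UNIV. pmf \<mu> S * of_bool (R \<subseteq> S))"
    by (rule sum.mono_neutral_cong_left) auto
  also have "\<dots> = (\<Sum>S\<in>U. pmf \<mu> S * of_bool (R \<subseteq> S))"
    using assms by (intro sum.mono_neutral_right) (auto simp: set_pmf_iff)
  finally show ?thesis .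
qed

text \<open>Linearity of expectation: averaging a multilinear polynomial at the indicator of
  \<open>S\<close> replaces each monomial by an inclusion probability.\<close>

lemma sum_pmf_incl_expansion:
  assumes "set_pmf \<mu> \<subseteq> U"
  shows "(\<Sum>S\<in>U. pmf \<mu> S * (\<Sum>R\<in>I. of_bool (R \<subseteq> S) * c R)) = (\<Sum>R\<in>I. incl_prob \<mu> R * c R)"
proof -
  have "(\<Sum>S\<in>U. pmf \<mu> S * (\<Sum>R\<in>I. of_bool (R \<subseteq> S) * c R)) =
      (\<Sum>S\<in>U. \<Sum>R\<in>I. pmf \<mu> S * of_bool (R \<subseteq> S) * c R)"
    by (simp only: sum_distrib_left mult.assoc)
  also have "\<dots> = (\<Sum>R\<in>I. \<Sum>S\<in>U. pmf \<mu> S * of_bool (R \<subseteq> S) * c R)"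
    by (rule sum.swap)
  finally show ?thesis by (simp only: incl_prob_eq_sum[OF assms] sum_distrib_right)
qed

lemma vol_norm_expansion:
  fixes v :: "'n::finite \<Rightarrow> real^'d"
  assumes "set_pmf \<mu> \<subseteq> U"
  shows "vol_norm v U \<mu> = (\<Sum>R | card R = CARD('d). incl_prob \<mu> R * det (gram v R))"
  unfolding vol_norm_def
  by (subst det_gram_expansion) (rule sum_pmf_incl_expansion[OF assms])

lemma vol_norm_pos:
  fixes v :: "'n::finite \<Rightarrow> real^'d"
  assumes sub: "set_pmf \<mu> \<subseteq> U" and indep: "approx_indep CARD('d) \<alpha> x \<mu>"
    and pos: "0 < det (\<Sum>i\<in>UNIV. x $ i *\<^sub>R outer (v i))"
  shows "0 < vol_norm v U \<mu>"
proof -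
  \<comment> \<open>A positive determinant has a positive term in its expansion.\<close>
  obtain R where R: "card R = CARD('d)" "0 < vpow x R * det (gram v R)"
    using pos unfolding det_weighted_sum_outer vpow_def[symmetric]
    by (metis (mono_tags, lifting) mem_Collect_eq not_le sum_nonpos)
  then have "0 < vpow x R" "0 < det (gram v R)"
    using det_gram_nonneg[of v R] by (auto simp: zero_less_mult_iff)
  \<comment> \<open>\<open>approx_indep\<close> speaks of pairs, so its positivity clause for
    \<open>R\<close> becomes available once some \<open>T\<close> of size
    \<open>CARD('d) - 1\<close> is supplied.\<close>
  moreover have "CARD('d) - 1 \<le> card R" using R(1) by simp
  then obtain T where "T \<subseteq> R" "card T = CARD('d) - 1"
    by (meson obtain_subset_with_card_n)
  then have "0 < incl_prob \<mu> R"
    using indep R(1) \<open>0 < vpow x R\<close> unfolding approx_indep_def by blast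
  ultimately show ?thesis
    unfolding vol_norm_expansion[OF sub]
    by (intro sum_pos2[of _ R]) (auto simp: R det_gram_nonneg incl_prob_def)
qed

text \<open>The inequality for each pair \<open>(T, R)\<close> is multiplied by
  \<open>g T * c R\<close> and summed; the cross-multiplied form avoids division by probabilities
  that may vanish.\<close>

lemma approx_indep_coeff_sums:
  fixes c g :: "'n::finite set \<Rightarrow> real"
  assumes indep: "approx_indep d \<alpha> x \<mu>"
    and "\<And>R. 0 \<le> c R" "\<And>T. 0 \<le> g T"
  shows "(\<Sum>T | card T = d - 1. incl_prob \<mu> T * g T) * (\<Sum>R | card R = d. vpow x R * c R) \<le>
    \<alpha> * (\<Sum>T | card T = d - 1. vpow x T * g T) * (\<Sum>R | card R = d. incl_prob \<mu> R * c R)"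
proof -
  have "(incl_prob \<mu> T * g T) * (vpow x R * c R) \<le> \<alpha> * ((vpow x T * g T) * (incl_prob \<mu> R * c R))"
    if "card T = d - 1" "card R = d" for T R
  proof -
    have "(incl_prob \<mu> T * vpow x R) * (g T * c R) \<le> (\<alpha> * vpow x T * incl_prob \<mu> R) * (g T * c R)"
      using indep that assms(2,3) by (intro mult_right_mono) (auto simp: approx_indep_def)
    then show ?thesis by (simp add: mult_ac)
  qed
  then show ?thesis
    unfolding mult.assoc sum_product by (auto simp: sum_distrib_left intro!: sum_mono)
qed

text \<open>The sampling weight \<open>det (gram v S)\<close> cancels the denominator of the trace.
  Equality may fail, since a set with singular Gram matrix is never sampled but can still contribute
  to the right-hand side.\<close>

lemma expected_tr_inv_vol_sampling_le:
  fixes v :: "'n::finite \<Rightarrow> real^'d"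
  assumes sub: "set_pmf \<mu> \<subseteq> U" and Z: "0 < vol_norm v U \<mu>"
  shows "(\<integral>\<^sup>+ S. tr_inv (gram v S) \<partial>measure_pmf (vol_sampling v U \<mu>)) \<le>
    ennreal ((\<Sum>T | card T = CARD('d) - 1. incl_prob \<mu> T * adj_coeff v T) / vol_norm v U \<mu>)"
proof -
  let ?P = "vol_sampling v U \<mu>"
  define g where "g S = (\<Sum>T | card T = CARD('d) - 1. of_bool (T \<subseteq> S) * adj_coeff v T)" for S
  have g_nonneg: "0 \<le> g S" for S by (simp add: g_def sum_nonneg adj_coeff_nonneg)
  have term_le: "ennreal (pmf ?P S) * tr_inv (gram v S) \<le> ennreal (pmf \<mu> S * g S / vol_norm v U \<mu>)" for S
  proof (cases "invertible (gram v S)")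
    case True
    have "pmf ?P S * trace (matrix_inv (gram v S)) = pmf \<mu> S * g S / vol_norm v U \<mu>"
      using det_mult_trace_inv_gram[OF True, folded g_def] by (simp add: pmf_vol_sampling[OF sub Z])
    then show ?thesis using True by (simp add: tr_inv_def flip: ennreal_mult')
  next
    case False
    \<comment> \<open>Probability zero absorbs the infinite value, as
      \<open>0 * \<infinity> = 0\<close> in \<open>ennreal\<close>.\<close>
    then have "pmf ?P S = 0"
      by (simp add: pmf_vol_sampling[OF sub Z] invertible_det_nz)
    then show ?thesis by simp
  qed
  have "(\<integral>\<^sup>+ S. tr_inv (gram v S) \<partial>measure_pmf ?P) = (\<Sum>S\<in>UNIV. ennreal (pmf ?P S) * tr_inv (gram v S))"
    by (simp add: nn_integral_measure_pmf nn_integral_count_space_finite)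
  also have "\<dots> \<le> (\<Sum>S\<in>UNIV. ennreal (pmf \<mu> S * g S / vol_norm v U \<mu>))"
    by (rule sum_mono) (rule term_le)
  also have "\<dots> = ennreal (\<Sum>S\<in>UNIV. pmf \<mu> S * g S / vol_norm v U \<mu>)"
    using g_nonneg Z by (intro sum_ennreal) auto
  also have "(\<Sum>S\<in>UNIV. pmf \<mu> S * g S / vol_norm v U \<mu>) =
      (\<Sum>T | card T = CARD('d) - 1. incl_prob \<mu> T * adj_coeff v T) / vol_norm v U \<mu>"
    unfolding g_def by (simp add: sum_pmf_incl_expansion flip: sum_divide_distrib del: sum_of_bool_mult_eq)
  finally show ?thesis .
qed

theorem theorem1p3:
  fixes v :: "'n::finite \<Rightarrow> real^'d"
    and k :: nat
    and U :: "'n set set"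
    and \<alpha> :: real
    and \<mu> :: "real^'n \<Rightarrow> 'n set pmf"
    and x :: "real^'n"
    and extend :: "'n set \<Rightarrow> 'n set pmf"
  assumes "CARD('d) \<le> k" and "k \<le> CARD('n)"
    and "span (range v) = UNIV"
    and "U = subsets_eq k \<or> U = subsets_le k"
    and "1 \<le> \<alpha>"
    and "\<And>y. y \<in> cp_feasible k \<Longrightarrow>
           set_pmf (\<mu> y) \<subseteq> U \<and> approx_indep CARD('d) \<alpha> y (\<mu> y)"
    and "cp_optimal v k x"
    and "\<And>S S'. S \<in> U \<Longrightarrow> S' \<in> set_pmf (extend S) \<Longrightarrow> S \<subseteq> S' \<and> card S' = k"
  shows "0 < vol_norm v U (\<mu> x) \<and>
    (\<integral>\<^sup>+ S'. tr_inv (gram v S') \<partial>measure_pmf (bind_pmf (vol_sampling v U (\<mu> x)) extend))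
      \<le> ennreal \<alpha> * OPT v k"
proof -
  define M where "M = (\<Sum>i\<in>UNIV. x $ i *\<^sub>R outer (v i))"
  let ?Z = "vol_norm v U (\<mu> x)" and ?P = "vol_sampling v U (\<mu> x)"
  let ?G = "\<Sum>T | card T = CARD('d) - 1. incl_prob (\<mu> x) T * adj_coeff v T"
  have x: "x \<in> cp_feasible k" using assms(7) by (simp add: cp_optimal_def)
  then have sub: "set_pmf (\<mu> x) \<subseteq> U" and indep: "approx_indep CARD('d) \<alpha> x (\<mu> x)"
    using assms(6) by auto
  have "0 < k" using assms(1) by (metis gr_zeroI not_le zero_less_card_finite)
  then have inv: "invertible M"
    unfolding M_def using assms(2,3,7) by (intro invertible_of_cp_optimal)
  have det_M: "det M = (\<Sum>R | card R = CARD('d). vpow x R * det (gram v R))"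
    by (simp add: M_def det_weighted_sum_outer vpow_def)
  have "0 \<le> det M"
    unfolding det_M using x
    by (intro sum_nonneg mult_nonneg_nonneg det_gram_nonneg) (auto simp: vpow_def cp_feasible_def intro: prod_nonneg)
  with inv have pos: "0 < det M" by (simp add: invertible_det_nz less_le)
  have Z: "0 < ?Z" using vol_norm_pos[OF sub indep] pos by (simp add: M_def)
  have tr_M: "det M * trace (matrix_inv M) = (\<Sum>T | card T = CARD('d) - 1. vpow x T * adj_coeff v T)"
    using det_mult_trace_inv_weighted_sum_outer[of "\<lambda>i. x $ i" v] inv by (simp add: M_def vpow_def)
  \<comment> \<open>The pairwise bounds are combined with coefficients \<open>adj_coeff v T\<close>
    and \<open>det (gram v R)\<close>.\<close>
  have "?G * det M \<le> \<alpha> * (det M * trace (matrix_inv M)) * ?Z"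
    unfolding tr_M unfolding det_M vol_norm_expansion[OF sub]
    by (rule approx_indep_coeff_sums[OF indep det_gram_nonneg adj_coeff_nonneg])
  then have "?G * det M \<le> (\<alpha> * trace (matrix_inv M) * ?Z) * det M" by (simp add: mult_ac)
  with pos Z have ratio: "?G / ?Z \<le> \<alpha> * trace (matrix_inv M)" by (simp add: divide_le_eq)
  \<comment> \<open>Sampled sets lie in \<open>U\<close>, so every extension contains the sampled
    set, and monotonicity allows \<open>S'\<close> to be replaced by \<open>S\<close> in the
    integrand.\<close>
  have "set_pmf ?P \<subseteq> U"
    using sub by (auto simp: set_pmf_iff pmf_vol_sampling[OF sub Z])
  then have "(\<integral>\<^sup>+ S'. tr_inv (gram v S') \<partial>measure_pmf (bind_pmf ?P extend)) \<le>
      (\<integral>\<^sup>+ S. \<integral>\<^sup>+ S'. tr_inv (gram v S) \<partial>measure_pmf (extend S) \<partial>measure_pmf ?P)"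
    unfolding nn_integral_bind_pmf using assms(8)
    by (intro nn_integral_mono_AE AE_pmfI tr_inv_gram_antimono) blast
  also have "\<dots> = (\<integral>\<^sup>+ S. tr_inv (gram v S) \<partial>measure_pmf ?P)" by simp
  also have "\<dots> \<le> ennreal (?G / ?Z)" by (rule expected_tr_inv_vol_sampling_le[OF sub Z])
  also have "\<dots> \<le> ennreal (\<alpha> * trace (matrix_inv M))" by (rule ennreal_leI[OF ratio])
  also have "\<dots> = ennreal \<alpha> * cp_objective v x"
    using inv assms(5) by (simp add: cp_objective_def tr_inv_def ennreal_mult' flip: M_def)
  also have "\<dots> \<le> ennreal \<alpha> * OPT v k"
    using cp_objective_optimal_le_OPT[OF assms(2,7)] by (rule mult_left_mono) simp
  finally show ?thesis using Z by simp
qed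

end
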